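(* Let $\mathcal C$ be a class of algebras (of a fixed finite type) closed under homomorphic images. Then $\mathcal C$ has finitely determined syntactic congruences (FDSC) if and only if $\mathcal C$ has term finite principal subcongruences (TFPSC).
   Context: Fix a denumerable set of variables $X=\{x,p_0,p_1,\dots\}$ with $x$ distinguished, and a set $T_x$ of terms over $X$ such that: $x\in T_x$; for each basic operation $\omega$ of positive arity $n$ and $i<n$, $\omega(p_0,\dots,p_{i-1},x,p_{i+1},\dots,p_{n-1})\in T_x$; and if $s(x,\bar p),t(x,\bar q)\in T_x$ then $s(t(x,\bar q),\bar p)\in T_x$. For $F\subseteq T_x$ and an algebra $\mathbf A$, $F^{\mathbf A}$ is the set of maps $a\mapsto t(a,\bar e)$ with $t(x,\bar p)\in F$, $\bar e$ from $A$; for an equivalence relation $\theta$ on $A$, $\theta_F=\{(a,b):(f(a),f(b))\in\theta\ \forall f\in F^{\mathbf A}\}$ and $\operatorname{syn}(\theta)=\theta_{T_x}$. $\mathcal C$ has FDSC if there is a finite $F\subseteq T_x$ with $\operatorname{syn}(\theta)=\theta_F$ for every equivalence relation $\theta$ on the carrier of every algebra of $\mathcal C$. A congruence formula is a first-order formula $\pi(u,v,x,y)$ of the form $\exists\bar p\,\bigl(u\approx t_0(z_0',\bar p)\wedge\bigwedge_{i=0}^{n-1}t_i(z_i,\bar p)\approx t_{i+1}(z_{i+1}',\bar p)\wedge t_n(z_n,\bar p)\approx v\bigr)$ with $t_i\in T_x$ and $\{z_i,z_i'\}=\{x,y\}$; $\operatorname{term}(\pi)=\{t_0,\dots,t_n\}$.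 For $F\subseteq T_x$, $\mathbf A$ and $a,b\in A$, $\theta^F(a,b)$ is the set of $(c,d)\in A^2$ with $\mathbf A\models\pi(c,d,a,b)$ for some congruence formula $\pi$ with $\operatorname{term}(\pi)\subseteq F$; $\theta(a,b)$ is the principal congruence generated by $(a,b)$. $\mathcal C$ has TFPSC if there are finite $F,G\subseteq T_x$ such that for every $\mathbf A\in\mathcal C$ and all distinct $a,b\in A$ there are distinct $c,d\in A$ with $(c,d)\in\theta^F(a,b)$ and $\theta(c,d)=\theta^G(c,d)$.
   Formalization: θ^F(a,b) is taken to include the diagonal of A, and each term t_i of a congruence formula has its own parameters (as literally written the claim fails, e.g. for sets or rings); in s(t(x,q),p) the parameters p and q are renamed apart. *)

theory Defs
  imports Main
begin

text \<open>A type of algebras: the arity of each operation symbol; symbols outside the domain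
  do not belong to the type.\<close>

type_synonym 'f signature = "'f \<rightharpoonup> nat"

record ('f, 'a) ualg =
  carrier :: "'a set"
  oper :: "'f \<Rightarrow> 'a list \<Rightarrow> 'a"

text \<open>The empty carrier is not excluded (when the type has no constants); the classes of
  nonempty algebras are particular cases.\<close>

definition is_algebra :: "'f signature \<Rightarrow> ('f, 'a) ualg \<Rightarrow> bool" where
  "is_algebra \<sigma> A \<longleftrightarrow>
     (\<forall>f n as. \<sigma> f = Some n \<and> length as = n \<and> set as \<subseteq> carrier A
        \<longrightarrow> oper A f as \<in> carrier A)"

definition is_hom :: "'f signature \<Rightarrow> ('f, 'a) ualg \<Rightarrow> ('f, 'b) ualg \<Rightarrow> ('a \<Rightarrow> 'b) \<Rightarrow> bool" where
  "is_hom \<sigma> A B h \<longleftrightarrow>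
     h ` carrier A \<subseteq> carrier B \<and>
     (\<forall>f n as. \<sigma> f = Some n \<and> length as = n \<and> set as \<subseteq> carrier A
        \<longrightarrow> h (oper A f as) = oper B f (map h as))"

text \<open>An image of an algebra with carrier in the type \<open>'a\<close> has a copy with carrier in \<open>'a\<close>,
  so nothing is lost by staying within one type. As any isomorphic copy is a homomorphic
  image, a closed class does not depend on the values of \<open>oper\<close> outside the carrier.\<close>

definition closed_under_hom_images :: "'f signature \<Rightarrow> ('f, 'a) ualg set \<Rightarrow> bool" where
  "closed_under_hom_images \<sigma> \<C> \<longleftrightarrow>
     (\<forall>A\<in>\<C>. \<forall>B h. is_algebra \<sigma> B \<and> is_hom \<sigma> A B h \<and> h ` carrier A = carrier B \<longrightarrow> B \<in> \<C>)"

definition is_congruence :: "'f signature \<Rightarrow> ('f, 'a) ualg \<Rightarrow> 'a rel \<Rightarrow> bool" where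
  "is_congruence \<sigma> A \<theta> \<longleftrightarrow>
     equiv (carrier A) \<theta> \<and>
     (\<forall>f n as bs. \<sigma> f = Some n \<and> length as = n \<and> list_all2 (\<lambda>a b. (a, b) \<in> \<theta>) as bs
        \<longrightarrow> (oper A f as, oper A f bs) \<in> \<theta>)"

definition principal_congruence :: "'f signature \<Rightarrow> ('f, 'a) ualg \<Rightarrow> 'a \<Rightarrow> 'a \<Rightarrow> 'a rel" where
  "principal_congruence \<sigma> A a b = \<Inter>{\<theta>. is_congruence \<sigma> A \<theta> \<and> (a, b) \<in> \<theta>}"

text \<open>The variables: the distinguished \<open>X\<close> and the parameters \<open>P 0, P 1, \<dots>\<close>.\<close>

datatype xvar = X | P nat

datatype 'f trm = Var xvar | App 'f "'f trm list"

primrec wf_trm :: "'f signature \<Rightarrow> 'f trm \<Rightarrow> bool" where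
  "wf_trm \<sigma> (Var v) \<longleftrightarrow> True"
| "wf_trm \<sigma> (App f ts) \<longleftrightarrow> \<sigma> f = Some (length ts) \<and> list_all (wf_trm \<sigma>) ts"

primrec trm_vars :: "'f trm \<Rightarrow> xvar set" where
  "trm_vars (Var v) = {v}"
| "trm_vars (App f ts) = \<Union>(set (map trm_vars ts))"

definition params :: "'f trm \<Rightarrow> nat set" where
  "params t = {i. P i \<in> trm_vars t}"

primrec subst :: "(xvar \<Rightarrow> 'f trm) \<Rightarrow> 'f trm \<Rightarrow> 'f trm" where
  "subst \<tau> (Var v) = \<tau> v"
| "subst \<tau> (App f ts) = App f (map (subst \<tau>) ts)"

definition rename :: "(nat \<Rightarrow> nat) \<Rightarrow> 'f trm \<Rightarrow> 'f trm" where
  "rename \<rho> = subst (case_xvar (Var X) (\<lambda>i. Var (P (\<rho> i))))"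

definition plug :: "'f trm \<Rightarrow> 'f trm \<Rightarrow> 'f trm" where
  "plug s t = subst (case_xvar t (\<lambda>i. Var (P i))) s"

text \<open>In the composite \<open>s(t(x,q),p)\<close> the parameters \<open>p\<close> and \<open>q\<close> are independent. The sets
  of parameters of \<open>s\<close> and \<open>t\<close> may well overlap, as they do for two terms built from basic
  operations, so they have to be renamed apart first; without this, \<open>f(p\<^sub>0,f(p\<^sub>1,x))\<close> is not
  generated from \<open>f(p\<^sub>0,x)\<close> and \<open>syn(\<theta>)\<close> need not be a congruence. It does not matter which
  names are used, and only one choice is required to be in \<open>T\<close>.\<close>

definition translation_terms :: "'f signature \<Rightarrow> 'f trm set \<Rightarrow> bool" where
  "translation_terms \<sigma> T \<longleftrightarrow>
     (\<forall>t\<in>T. wf_trm \<sigma> t) \<and>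
     Var X \<in> T \<and>
     (\<forall>f n i. \<sigma> f = Some n \<and> i < n
        \<longrightarrow> App f (map (\<lambda>j. if j = i then Var X else Var (P j)) [0..<n]) \<in> T) \<and>
     (\<forall>s\<in>T. \<forall>t\<in>T. \<exists>\<rho> \<rho>'. inj \<rho> \<and> inj \<rho>' \<and> \<rho> ` params s \<inter> \<rho>' ` params t = {} \<and>
        plug (rename \<rho> s) (rename \<rho>' t) \<in> T)"

primrec eval_trm :: "('f, 'a) ualg \<Rightarrow> (xvar \<Rightarrow> 'a) \<Rightarrow> 'f trm \<Rightarrow> 'a" where
  "eval_trm A v (Var y) = v y"
| "eval_trm A v (App f ts) = oper A f (map (eval_trm A v) ts)"

definition trm_map :: "('f, 'a) ualg \<Rightarrow> 'f trm \<Rightarrow> (nat \<Rightarrow> 'a) \<Rightarrow> 'a \<Rightarrow> 'a" where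
  "trm_map A t e a = eval_trm A (case_xvar a e) t"

definition maps_of :: "'f trm set \<Rightarrow> ('f, 'a) ualg \<Rightarrow> ('a \<Rightarrow> 'a) set" where
  "maps_of F A = {trm_map A t e | t e. t \<in> F \<and> range e \<subseteq> carrier A}"

definition rel_of :: "'f trm set \<Rightarrow> ('f, 'a) ualg \<Rightarrow> 'a rel \<Rightarrow> 'a rel" where
  "rel_of F A \<theta> =
     {(a, b). a \<in> carrier A \<and> b \<in> carrier A \<and> (\<forall>f\<in>maps_of F A. (f a, f b) \<in> \<theta>)}"

definition syn :: "'f trm set \<Rightarrow> ('f, 'a) ualg \<Rightarrow> 'a rel \<Rightarrow> 'a rel" where
  "syn T A \<theta> = rel_of T A \<theta>"

definition FDSC :: "'f trm set \<Rightarrow> ('f, 'a) ualg set \<Rightarrow> bool" where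
  "FDSC T \<C> \<longleftrightarrow>
     (\<exists>F. finite F \<and> F \<subseteq> T \<and>
        (\<forall>A\<in>\<C>. \<forall>\<theta>. equiv (carrier A) \<theta> \<longrightarrow> syn T A \<theta> = rel_of F A \<theta>))"

text \<open>A congruence formula is given by the nonempty list of its terms \<open>t\<^sub>0, \<dots>, t\<^sub>n\<close>, each
  with an orientation: \<open>(z\<^sub>i', z\<^sub>i)\<close> is \<open>(x, y)\<close> for \<open>True\<close> and \<open>(y, x)\<close> for \<open>False\<close>.\<close>

type_synonym 'f cformula = "('f trm \<times> bool) list"

definition terms_of :: "'f cformula \<Rightarrow> 'f trm set" where
  "terms_of \<pi> = fst ` set \<pi>"

definition congruence_formula :: "'f trm set \<Rightarrow> 'f cformula \<Rightarrow> bool" where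
  "congruence_formula T \<pi> \<longleftrightarrow> \<pi> \<noteq> [] \<and> terms_of \<pi> \<subseteq> T"

text \<open>\<open>A \<Turnstile> \<pi>(u, v, x, y)\<close>. The quantified tuple of parameters comprises a separate block
  \<open>p i\<close> for each term \<open>t\<^sub>i\<close>: the same term may be used with different parameters
  at different links, as in Maltsev chains. If all links shared the parameters, a finite set
  of terms would only give chains of bounded length.\<close>

definition sat :: "('f, 'a) ualg \<Rightarrow> 'f cformula \<Rightarrow> 'a \<Rightarrow> 'a \<Rightarrow> 'a \<Rightarrow> 'a \<Rightarrow> bool" where
  "sat A \<pi> u v x y \<longleftrightarrow>
     (\<exists>p :: nat \<Rightarrow> nat \<Rightarrow> 'a.
        let n = length \<pi> - 1;
            t = (\<lambda>i. fst (\<pi> ! i));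
            z' = (\<lambda>i. if snd (\<pi> ! i) then x else y);
            z = (\<lambda>i. if snd (\<pi> ! i) then y else x)
        in (\<forall>i. range (p i) \<subseteq> carrier A) \<and>
           u = trm_map A (t 0) (p 0) (z' 0) \<and>
           (\<forall>i<n. trm_map A (t i) (p i) (z i) = trm_map A (t (Suc i)) (p (Suc i)) (z' (Suc i))) \<and>
           trm_map A (t n) (p n) (z n) = v)"

text \<open>The diagonal is included explicitly, as the trivial congruence formula \<open>u \<approx> v\<close> would do.
  The terms in \<open>T\<close> need not express constant maps, so an element outside all their images
  would otherwise not be related to itself, and even \<open>F = T\<close> would not give the principal
  congruence. If \<open>T\<close> contains a parameter, say \<open>p\<^sub>0\<close>, adding it to \<open>F\<close> has the
  same effect.\<close>

definition theta_of :: "'f trm set \<Rightarrow> 'f trm set \<Rightarrow> ('f, 'a) ualg \<Rightarrow> 'a \<Rightarrow> 'a \<Rightarrow> 'a rel" where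
  "theta_of T F A a b =
     {(c, d). c \<in> carrier A \<and> d \<in> carrier A \<and>
        (c = d \<or> (\<exists>\<pi>. congruence_formula T \<pi> \<and> terms_of \<pi> \<subseteq> F \<and> sat A \<pi> c d a b))}"

definition TFPSC :: "'f signature \<Rightarrow> 'f trm set \<Rightarrow> ('f, 'a) ualg set \<Rightarrow> bool" where
  "TFPSC \<sigma> T \<C> \<longleftrightarrow>
     (\<exists>F G. finite F \<and> F \<subseteq> T \<and> finite G \<and> G \<subseteq> T \<and>
        (\<forall>A\<in>\<C>. \<forall>a\<in>carrier A. \<forall>b\<in>carrier A. a \<noteq> b \<longrightarrow>
           (\<exists>c\<in>carrier A. \<exists>d\<in>carrier A. c \<noteq> d \<and> (c, d) \<in> theta_of T F A a b \<and>
              principal_congruence \<sigma> A c d = theta_of T G A c d)))"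

end

theory Submission
  imports Defs
begin

text \<open>The relation \<open>syn(\<theta>)\<close> is a congruence contained in \<open>\<theta>\<close>, and \<open>\<theta>\<^sup>F(a,b)\<close> is the
  equivalence generated by the pairs \<open>(f(a), f(b))\<close> with \<open>f\<close> in \<open>F\<^sup>A\<close>. If \<open>F\<close> determines
  syntactic congruences, then \<open>(a,b) \<in> \<Theta>\<^sub>F = syn(\<Theta>)\<close> for \<open>\<Theta> = \<theta>\<^sup>F(a,b)\<close>, whence
  \<open>\<Theta>\<close> is the principal congruence of \<open>(a,b)\<close>. Conversely, given \<open>F\<close> and \<open>G\<close> as in TFPSC, the
  composites \<open>g(f(x,p),q)\<close> with \<open>f \<in> F\<close>, \<open>g \<in> G\<close> determine \<open>syn(\<theta>)\<close>: if they map \<open>(a,b)\<close> into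
  \<open>\<theta>\<close> but \<open>(a,b) \<notin> syn(\<theta>)\<close>, then in the quotient by \<open>syn(\<theta>)\<close> there are distinct \<open>c, d\<close>
  whose principal congruence lies inside the image of \<open>\<theta>\<close>, although that image contains no
  nontrivial congruence.\<close>

section \<open>Evaluation of terms\<close>

lemma eval_subst: "eval_trm A v (subst \<tau> t) = eval_trm A (\<lambda>y. eval_trm A v (\<tau> y)) t"
  by (induction t) (auto simp: o_def intro!: arg_cong[of _ _ "oper A _"])

lemma eval_cong: "(\<And>y. y \<in> trm_vars t \<Longrightarrow> v y = w y) \<Longrightarrow> eval_trm A v t = eval_trm A w t"
proof (induction t)
  case (App f ts)
  then have "map (eval_trm A v) ts = map (eval_trm A w) ts" by auto
  then show ?case by (simp del: map_eq_conv)
qed simp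

lemma eval_closed:
  assumes "is_algebra \<sigma> A" "wf_trm \<sigma> t" "range v \<subseteq> carrier A"
  shows "eval_trm A v t \<in> carrier A"
  using assms(2)
proof (induction t)
  case (Var x)
  then show ?case using assms(3) by auto
next
  case (App f ts)
  then have "set (map (eval_trm A v) ts) \<subseteq> carrier A" by (auto simp: list_all_iff)
  then show ?case using App.prems assms(1) by (auto simp: is_algebra_def)
qed

lemma eval_hom:
  assumes "is_algebra \<sigma> A" "is_hom \<sigma> A B h" "wf_trm \<sigma> t" "range v \<subseteq> carrier A"
  shows "eval_trm B (h \<circ> v) t = h (eval_trm A v t)"
  using assms(3)
proof (induction t)
  case (App f ts)
  then have wf: "\<And>t. t \<in> set ts \<Longrightarrow> wf_trm \<sigma> t" by (auto simp: list_all_iff)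
  then have "set (map (eval_trm A v) ts) \<subseteq> carrier A"
    using eval_closed[OF assms(1) _ assms(4)] by auto
  then have "h (oper A f (map (eval_trm A v) ts)) = oper B f (map h (map (eval_trm A v) ts))"
    using App.prems assms(2) unfolding is_hom_def by (metis length_map wf_trm.simps(2))
  moreover have "map h (map (eval_trm A v) ts) = map (eval_trm B (h \<circ> v)) ts"
    using App.IH wf by (simp add: o_def)
  ultimately show ?case by (simp only: eval_trm.simps)
qed simp

lemma eval_congruence:
  assumes "is_congruence \<sigma> A \<psi>" "wf_trm \<sigma> t" "\<And>y. (v y, w y) \<in> \<psi>"
  shows "(eval_trm A v t, eval_trm A w t) \<in> \<psi>"
  using assms(2)
proof (induction t)
  case (App f ts)
  then have "list_all2 (\<lambda>a b. (a, b) \<in> \<psi>) (map (eval_trm A v) ts) (map (eval_trm A w) ts)"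
    by (auto simp: list_all2_conv_all_nth list_all_iff)
  then show ?case using App.prems assms(1) unfolding is_congruence_def by auto
qed (simp add: assms(3))

lemma range_case_xvar: "a \<in> S \<Longrightarrow> range e \<subseteq> S \<Longrightarrow> range (case_xvar a e) \<subseteq> S"
  by (auto simp: image_subset_iff split: xvar.split)

lemma trm_map_closed:
  assumes "is_algebra \<sigma> A" "wf_trm \<sigma> t" "a \<in> carrier A" "range e \<subseteq> carrier A"
  shows "trm_map A t e a \<in> carrier A"
  unfolding trm_map_def by (rule eval_closed[OF assms(1,2)]) (rule range_case_xvar[OF assms(3,4)])

lemma trm_map_hom:
  assumes "is_algebra \<sigma> A" "is_hom \<sigma> A B h" "wf_trm \<sigma> t" "a \<in> carrier A" "range e \<subseteq> carrier A"
  shows "trm_map B t (h \<circ> e) (h a) = h (trm_map A t e a)"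
proof -
  have "case_xvar (h a) (h \<circ> e) = h \<circ> case_xvar a e"
    by (auto simp: fun_eq_iff split: xvar.split)
  then show ?thesis
    unfolding trm_map_def
    using eval_hom[OF assms(1-3) range_case_xvar[OF assms(4,5)]] by simp
qed

lemma trm_map_congruence:
  assumes "is_congruence \<sigma> A \<psi>" "wf_trm \<sigma> t" "(a, b) \<in> \<psi>" "range e \<subseteq> carrier A"
  shows "(trm_map A t e a, trm_map A t e b) \<in> \<psi>"
  unfolding trm_map_def
proof (rule eval_congruence[OF assms(1,2)])
  have "refl_on (carrier A) \<psi>" using assms(1) by (auto simp: is_congruence_def equiv_def)
  then show "(case_xvar a e y, case_xvar b e y) \<in> \<psi>" for y
    using assms(3,4) by (auto simp: refl_on_def split: xvar.split)
qed

text \<open>Disjointness of the renamed parameters lets one assignment serve both terms, so plugging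
  terms realises the composition of their maps for arbitrary, independent parameters
  \<open>p\<close> and \<open>q\<close>.\<close>

lemma trm_map_plug_rename:
  assumes "inj \<rho>" "inj \<rho>'" "\<rho> ` params s \<inter> \<rho>' ` params t = {}"
    and "range p \<subseteq> S" "range q \<subseteq> S"
  shows "\<exists>e. range e \<subseteq> S \<and>
    (\<forall>a. trm_map A (plug (rename \<rho> s) (rename \<rho>' t)) e a = trm_map A s p (trm_map A t q a))"
proof -
  \<comment> \<open>Only the values at renamed parameters matter. Every other index falls under the
    second case, which still lies in \<open>S\<close> because the whole range of \<open>q\<close>
    does.\<close>
  define e where "e k = (if k \<in> \<rho> ` params s then p (inv \<rho> k) else q (inv \<rho>' k))" for k
  have e_s: "e (\<rho> i) = p i" if "i \<in> params s" for i
    using that assms(1) by (simp add: e_def)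
  have e_t: "e (\<rho>' i) = q i" if "i \<in> params t" for i
  proof -
    have "\<rho>' i \<notin> \<rho> ` params s" using that assms(3) by blast
    then show ?thesis using assms(2) by (simp add: e_def)
  qed
  have t: "eval_trm A (case_xvar a e) (rename \<rho>' t) = trm_map A t q a" for a
    unfolding rename_def eval_subst trm_map_def
    by (rule eval_cong) (auto simp: params_def e_t split: xvar.split)
  have "trm_map A (plug (rename \<rho> s) (rename \<rho>' t)) e a = trm_map A s p (trm_map A t q a)" for a
    unfolding trm_map_def[of _ "plug _ _"] trm_map_def[of _ s]
    unfolding plug_def rename_def[of \<rho>] eval_subst
    by (rule eval_cong) (auto simp: params_def e_s t split: xvar.split)
  moreover have "range e \<subseteq> S" using assms(4,5) by (auto simp: e_def)
  ultimately show ?thesis by blast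
qed

section \<open>Translations and syntactic congruences\<close>

lemma translation_terms_wf: "translation_terms \<sigma> T \<Longrightarrow> t \<in> T \<Longrightarrow> wf_trm \<sigma> t"
  by (simp add: translation_terms_def)

lemma translation_terms_Var: "translation_terms \<sigma> T \<Longrightarrow> Var X \<in> T"
  by (simp add: translation_terms_def)

text \<open>The order of quantifiers is the point: \<open>r\<close> depends on \<open>s\<close> and
  \<open>t\<close> alone and works for all algebras and parameters. Hence finitely many pairs of
  terms give finitely many composites.\<close>

lemma translation_terms_compose:
  fixes T :: "'f trm set"
  assumes "translation_terms \<sigma> T" "s \<in> T" "t \<in> T"
  shows "\<exists>r\<in>T. \<forall>(A :: ('f, 'a) ualg) p q. range p \<subseteq> carrier A \<and> range q \<subseteq> carrier A \<longrightarrow>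
    (\<exists>e. range e \<subseteq> carrier A \<and> (\<forall>a. trm_map A r e a = trm_map A s p (trm_map A t q a)))"
proof -
  have "\<forall>s\<in>T. \<forall>t\<in>T. \<exists>\<rho> \<rho>'. inj \<rho> \<and> inj \<rho>' \<and> \<rho> ` params s \<inter> \<rho>' ` params t = {} \<and>
      plug (rename \<rho> s) (rename \<rho>' t) \<in> T"
    using assms(1) by (simp add: translation_terms_def)
  from this[rule_format, OF assms(2,3)] obtain \<rho> \<rho>' where
    \<rho>: "inj \<rho>" "inj \<rho>'" "\<rho> ` params s \<inter> \<rho>' ` params t = {}"
    and T: "plug (rename \<rho> s) (rename \<rho>' t) \<in> T"
    by (elim exE conjE)
  show ?thesis
    by (rule bexI[OF _ T]) (intro allI impI trm_map_plug_rename \<rho>, simp_all)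
qed

lemma maps_of_closed:
  assumes "is_algebra \<sigma> A" "\<And>t. t \<in> F \<Longrightarrow> wf_trm \<sigma> t" "f \<in> maps_of F A" "a \<in> carrier A"
  shows "f a \<in> carrier A"
  using assms(3) trm_map_closed[OF assms(1) assms(2) assms(4)] by (auto simp: maps_of_def)

text \<open>An element of the carrier is required since even a term without parameters is evaluated
  under a parameter assignment; over an empty carrier \<open>maps_of F A\<close> is empty.\<close>

lemma maps_of_id:
  assumes "Var X \<in> F" "a \<in> carrier A"
  shows "(\<lambda>x. x) \<in> maps_of F A"
proof -
  have "(\<lambda>x. x) = trm_map A (Var X) (\<lambda>_. a)" by (simp add: trm_map_def fun_eq_iff)
  then show ?thesis using assms unfolding maps_of_def by blast
qed

lemma maps_of_compose:
  assumes "translation_terms \<sigma> T" "f \<in> maps_of T A" "g \<in> maps_of T A"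
  shows "(\<lambda>x. g (f x)) \<in> maps_of T A"
proof -
  obtain s p t q where *: "g = trm_map A s p" "s \<in> T" "range p \<subseteq> carrier A"
    "f = trm_map A t q" "t \<in> T" "range q \<subseteq> carrier A"
    using assms(2,3) unfolding maps_of_def by blast
  obtain r e where "r \<in> T" "range e \<subseteq> carrier A"
    "\<forall>a. trm_map A r e a = trm_map A s p (trm_map A t q a)"
    using translation_terms_compose[OF assms(1) *(2,5), rule_format] *(3,6) by meson
  then have "(\<lambda>x. g (f x)) = trm_map A r e" by (simp add: * fun_eq_iff)
  then show ?thesis using \<open>r \<in> T\<close> \<open>range e \<subseteq> carrier A\<close> unfolding maps_of_def by blast
qed

lemma maps_of_basic:
  assumes "translation_terms \<sigma> T" "\<sigma> f = Some (length as)" "i < length as" "set as \<subseteq> carrier A"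
  shows "(\<lambda>x. oper A f (as[i := x])) \<in> maps_of T A"
proof -
  let ?t = "App f (map (\<lambda>j. if j = i then Var X else Var (P j)) [0..<length as])"
  \<comment> \<open>Indices beyond the arity get the default \<open>as ! i\<close>, which keeps the
    range of \<open>e\<close> in the carrier; \<open>i < length as\<close> guarantees that this
    entry exists.\<close>
  define e where "e j = as ! (if j < length as then j else i)" for j
  have "map (eval_trm A (case_xvar x e))
      (map (\<lambda>j. if j = i then Var X else Var (P j)) [0..<length as]) = as[i := x]" for x
    using assms(3) by (auto intro!: nth_equalityI simp: e_def nth_list_update)
  then have "(\<lambda>x. oper A f (as[i := x])) = trm_map A ?t e"
    unfolding trm_map_def eval_trm.simps by simp
  moreover have "?t \<in> T" using assms(1-3) unfolding translation_terms_def by blast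
  moreover have "range e \<subseteq> carrier A" using assms(3,4) nth_mem by (fastforce simp: e_def)
  ultimately show ?thesis unfolding maps_of_def by blast
qed

text \<open>This is the intersection of the preimages of \<theta> under the maps in
  \<open>maps_of F A\<close>. Reflexivity uses that these maps preserve the carrier.\<close>

lemma equiv_rel_of:
  assumes "is_algebra \<sigma> A" "\<And>t. t \<in> F \<Longrightarrow> wf_trm \<sigma> t" "equiv (carrier A) \<theta>"
  shows "equiv (carrier A) (rel_of F A \<theta>)"
proof -
  have "refl_on (carrier A) \<theta>" "sym \<theta>" "trans \<theta>" using assms(3) by (auto simp: equiv_def)
  moreover have "f a \<in> carrier A" if "f \<in> maps_of F A" "a \<in> carrier A" for f a
    using maps_of_closed[OF assms(1,2) that] .
  ultimately have "refl_on (carrier A) (rel_of F A \<theta>)" "sym (rel_of F A \<theta>)"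
    "trans (rel_of F A \<theta>)"
    unfolding rel_of_def refl_on_def sym_def trans_def by blast+
  then show ?thesis by (intro equivI) (auto simp: rel_of_def)
qed

lemma rel_of_mono: "F \<subseteq> G \<Longrightarrow> rel_of G A \<theta> \<subseteq> rel_of F A \<theta>"
  unfolding rel_of_def maps_of_def by blast

text \<open>By transitivity, arguments can be exchanged one at a time, so compatibility with the
  basic translations suffices.\<close>

lemma is_congruence_by_coordinates:
  assumes "is_algebra \<sigma> A" and eq: "equiv (carrier A) \<psi>"
    and coord: "\<And>f as i a b. \<sigma> f = Some (length as) \<Longrightarrow> i < length as \<Longrightarrow> set as \<subseteq> carrier A \<Longrightarrow>
      (a, b) \<in> \<psi> \<Longrightarrow> (oper A f (as[i := a]), oper A f (as[i := b])) \<in> \<psi>"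
  shows "is_congruence \<sigma> A \<psi>"
  unfolding is_congruence_def
proof (intro conjI allI impI eq, elim conjE)
  fix f n as bs
  assume f: "\<sigma> f = Some n" and len: "length as = n"
    and rel: "list_all2 (\<lambda>a b. (a, b) \<in> \<psi>) as bs"
  have nth: "(as ! i, bs ! i) \<in> \<psi>" if "i < n" for i
    using rel len that by (auto simp: list_all2_conv_all_nth)
  have len': "length bs = n" using rel len by (auto dest: list_all2_lengthD)
  have sub: "\<psi> \<subseteq> carrier A \<times> carrier A" using eq by (auto simp: equiv_def)
  have carr: "set as \<subseteq> carrier A" "set bs \<subseteq> carrier A"
    using nth sub len len' by (fastforce simp: set_conv_nth)+
  \<comment> \<open>The hybrid list has its first \<open>k\<close> entries already exchanged: it is
    \<open>as\<close> for \<open>k = 0\<close> and \<open>bs\<close> for \<open>k = n\<close>, and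
    consecutive hybrids differ at position \<open>k\<close> only.\<close>
  have "k \<le> n \<Longrightarrow> (oper A f as, oper A f (take k bs @ drop k as)) \<in> \<psi>" for k
  proof (induction k)
    case 0
    have "oper A f as \<in> carrier A" using assms(1) f len carr by (auto simp: is_algebra_def)
    then show ?case using eq by (auto simp: equiv_def refl_on_def)
  next
    case (Suc k)
    let ?cs = "take k bs @ drop k as"
    have k: "k < n" using Suc.prems by simp
    have "set ?cs \<subseteq> carrier A" using carr by (auto dest!: in_set_takeD in_set_dropD)
    then have "(oper A f (?cs[k := as ! k]), oper A f (?cs[k := bs ! k])) \<in> \<psi>"
      using coord[of f ?cs k] f len len' k nth by simp
    moreover have "?cs[k := as ! k] = ?cs"
      using k len len' by (intro list_update_same_conv[THEN iffD2]) (auto simp: nth_append)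
    moreover have "?cs[k := bs ! k] = take (Suc k) bs @ drop (Suc k) as"
      using k len len' by (auto intro!: nth_equalityI simp: nth_append nth_list_update less_Suc_eq)
    ultimately show ?case using Suc eq by (auto simp: equiv_def elim: transE)
  qed
  from this[of n] show "(oper A f as, oper A f bs) \<in> \<psi>" using len len' by simp
qed

text \<open>A basic translation followed by a map from \<open>T\<close> is again a map from
  \<open>T\<close>, so applying a basic translation to a pair of \<open>syn T A \<theta>\<close>
  does not leave the relation.\<close>

lemma is_congruence_syn:
  assumes "is_algebra \<sigma> A" "translation_terms \<sigma> T" "equiv (carrier A) \<theta>"
  shows "is_congruence \<sigma> A (syn T A \<theta>)"
proof (rule is_congruence_by_coordinates[OF assms(1)])
  note wf = translation_terms_wf[OF assms(2)]
  show "equiv (carrier A) (syn T A \<theta>)"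
    unfolding syn_def using equiv_rel_of[OF assms(1) _ assms(3)] wf by blast
  fix f as i a b
  assume "\<sigma> f = Some (length as)" "i < length as" "set as \<subseteq> carrier A"
  then have m: "(\<lambda>x. oper A f (as[i := x])) \<in> maps_of T A"
    by (rule maps_of_basic[OF assms(2)])
  assume ab: "(a, b) \<in> syn T A \<theta>"
  then show "(oper A f (as[i := a]), oper A f (as[i := b])) \<in> syn T A \<theta>"
    using maps_of_compose[OF assms(2) m] maps_of_closed[OF assms(1) wf m]
    unfolding syn_def rel_of_def by auto
qed

lemma syn_subset:
  assumes "translation_terms \<sigma> T"
  shows "syn T A \<theta> \<subseteq> \<theta>"
proof (rule subrelI)
  fix a b assume ab: "(a, b) \<in> syn T A \<theta>"
  then have "a \<in> carrier A" by (simp add: syn_def rel_of_def)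
  then have "(\<lambda>x. x) \<in> maps_of T A" by (rule maps_of_id[OF translation_terms_Var[OF assms]])
  moreover have "\<forall>f\<in>maps_of T A. (f a, f b) \<in> \<theta>" using ab by (simp add: syn_def rel_of_def)
  ultimately show "(a, b) \<in> \<theta>" by (auto dest: bspec)
qed

section \<open>Congruence formulas\<close>

text \<open>One step of a Maltsev chain. Symmetrising replaces the orientations in a congruence
  formula, so that satisfaction of formulas becomes a transitive closure.\<close>

definition link :: "'f trm set \<Rightarrow> ('f, 'a) ualg \<Rightarrow> 'a \<Rightarrow> 'a \<Rightarrow> 'a rel" where
  "link F A a b = (\<Union>f\<in>maps_of F A. {(f a, f b), (f b, f a)})"

lemma sat_singleton_iff: "sat A [(t, z)] u v a b \<longleftrightarrow>
  (\<exists>e. range e \<subseteq> carrier A \<and> u = trm_map A t e (if z then a else b) \<and>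
    v = trm_map A t e (if z then b else a))"
proof
  assume "sat A [(t, z)] u v a b"
  then show "\<exists>e. range e \<subseteq> carrier A \<and> u = trm_map A t e (if z then a else b) \<and>
      v = trm_map A t e (if z then b else a)"
    unfolding sat_def Let_def by fastforce
next
  assume "\<exists>e. range e \<subseteq> carrier A \<and> u = trm_map A t e (if z then a else b) \<and>
      v = trm_map A t e (if z then b else a)"
  then obtain e where "range e \<subseteq> carrier A" "u = trm_map A t e (if z then a else b)"
      "v = trm_map A t e (if z then b else a)"
    by (elim exE conjE)
  then show "sat A [(t, z)] u v a b"
    unfolding sat_def Let_def by (intro exI[of _ "\<lambda>_. e"]) simp
qed

text \<open>Each link has its own block of parameters, so the first link can be split off and the
  two parts chosen independently. This is what makes induction on formulas possible.\<close>

lemma sat_Cons_iff: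
  assumes "\<pi> \<noteq> []"
  shows "sat A ((t, z) # \<pi>) u v a b \<longleftrightarrow> (\<exists>w. sat A [(t, z)] u w a b \<and> sat A \<pi> w v a b)"
proof
  assume "sat A ((t, z) # \<pi>) u v a b"
  then obtain p where p: "\<forall>i. range (p i) \<subseteq> carrier A"
    "u = trm_map A t (p 0) (if z then a else b)"
    "\<And>i. i < length \<pi> \<Longrightarrow>
       trm_map A (fst (((t, z) # \<pi>) ! i)) (p i) (if snd (((t, z) # \<pi>) ! i) then b else a) =
       trm_map A (fst (\<pi> ! i)) (p (Suc i)) (if snd (\<pi> ! i) then a else b)"
    "trm_map A (fst (((t, z) # \<pi>) ! length \<pi>)) (p (length \<pi>))
       (if snd (((t, z) # \<pi>) ! length \<pi>) then b else a) = v"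
    unfolding sat_def by (auto simp: Let_def)
  \<comment> \<open>The intermediate element is the right end of the first link; the rest of the
    chain uses the parameter blocks shifted by one.\<close>
  let ?w = "trm_map A t (p 0) (if z then b else a)"
  have "sat A [(t, z)] u ?w a b" using p(1,2) by (auto simp: sat_singleton_iff)
  moreover have "sat A \<pi> ?w v a b"
    unfolding sat_def Let_def
  proof (rule exI[of _ "\<lambda>i. p (Suc i)"], intro conjI allI impI)
    show "?w = trm_map A (fst (\<pi> ! 0)) (p (Suc 0)) (if snd (\<pi> ! 0) then a else b)"
      using p(3)[of 0] assms by simp
    show "trm_map A (fst (\<pi> ! i)) (p (Suc i)) (if snd (\<pi> ! i) then b else a) =
        trm_map A (fst (\<pi> ! Suc i)) (p (Suc (Suc i))) (if snd (\<pi> ! Suc i) then a else b)"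
      if "i < length \<pi> - 1" for i
      using p(3)[of "Suc i"] that by simp
    show "trm_map A (fst (\<pi> ! (length \<pi> - 1))) (p (Suc (length \<pi> - 1)))
        (if snd (\<pi> ! (length \<pi> - 1)) then b else a) = v"
      using p(4) assms by (cases \<pi>) auto
  qed (use p(1) in blast)
  ultimately show "\<exists>w. sat A [(t, z)] u w a b \<and> sat A \<pi> w v a b" by blast
next
  assume "\<exists>w. sat A [(t, z)] u w a b \<and> sat A \<pi> w v a b"
  then obtain w e p where e: "range e \<subseteq> carrier A" "u = trm_map A t e (if z then a else b)"
    "w = trm_map A t e (if z then b else a)"
    and p: "\<forall>i. range (p i) \<subseteq> carrier A"
    "w = trm_map A (fst (\<pi> ! 0)) (p 0) (if snd (\<pi> ! 0) then a else b)"
    "\<And>i. i < length \<pi> - 1 \<Longrightarrow> trm_map A (fst (\<pi> ! i)) (p i) (if snd (\<pi> ! i) then b else a) =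
       trm_map A (fst (\<pi> ! Suc i)) (p (Suc i)) (if snd (\<pi> ! Suc i) then a else b)"
    "trm_map A (fst (\<pi> ! (length \<pi> - 1))) (p (length \<pi> - 1))
       (if snd (\<pi> ! (length \<pi> - 1)) then b else a) = v"
    unfolding sat_singleton_iff sat_def[of _ \<pi>] Let_def by auto
  \<comment> \<open>The block \<open>e\<close> is prepended to the blocks \<open>p\<close>. The
    equation at index 0 is the junction at \<open>w\<close>; the one at \<open>i > 0\<close> is the
    equation of \<pi> at \<open>i - 1\<close>.\<close>
  show "sat A ((t, z) # \<pi>) u v a b"
    unfolding sat_def Let_def
  proof (rule exI[of _ "case_nat e p"], intro conjI allI impI)
    show "range (case_nat e p i) \<subseteq> carrier A" for i
      using e(1) p(1) by (cases i) auto
    show "u = trm_map A (fst (((t, z) # \<pi>) ! 0)) (case_nat e p 0)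
        (if snd (((t, z) # \<pi>) ! 0) then a else b)"
      using e(2) by simp
    show "trm_map A (fst (((t, z) # \<pi>) ! i)) (case_nat e p i)
        (if snd (((t, z) # \<pi>) ! i) then b else a) =
      trm_map A (fst (((t, z) # \<pi>) ! Suc i)) (case_nat e p (Suc i))
        (if snd (((t, z) # \<pi>) ! Suc i) then a else b)"
      if "i < length ((t, z) # \<pi>) - 1" for i
      using that e(3) p(2) p(3)[of "i - 1"] by (cases i) auto
    show "trm_map A (fst (((t, z) # \<pi>) ! (length ((t, z) # \<pi>) - 1)))
        (case_nat e p (length ((t, z) # \<pi>) - 1))
        (if snd (((t, z) # \<pi>) ! (length ((t, z) # \<pi>) - 1)) then b else a) = v"
      using p(4) assms by (cases \<pi>) auto
  qed
qed

lemma link_iff_sat: "(u, v) \<in> link F A a b \<longleftrightarrow> (\<exists>t z. t \<in> F \<and> sat A [(t, z)] u v a b)"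
proof
  assume "(u, v) \<in> link F A a b"
  then obtain t e where t: "t \<in> F" "range e \<subseteq> carrier A"
    and "(u, v) = (trm_map A t e a, trm_map A t e b) \<or> (u, v) = (trm_map A t e b, trm_map A t e a)"
    unfolding link_def maps_of_def by auto
  then have "sat A [(t, True)] u v a b \<or> sat A [(t, False)] u v a b"
    unfolding sat_singleton_iff by auto
  then show "\<exists>t z. t \<in> F \<and> sat A [(t, z)] u v a b" using t(1) by blast
next
  assume "\<exists>t z. t \<in> F \<and> sat A [(t, z)] u v a b"
  then obtain t z e where "trm_map A t e \<in> maps_of F A"
    "u = trm_map A t e (if z then a else b)" "v = trm_map A t e (if z then b else a)"
    unfolding sat_singleton_iff maps_of_def by blast
  then show "(u, v) \<in> link F A a b" unfolding link_def by (cases z) auto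
qed

lemma sat_imp_trancl_link:
  assumes "sat A \<pi> u v a b" "\<pi> \<noteq> []" "terms_of \<pi> \<subseteq> F"
  shows "(u, v) \<in> (link F A a b)\<^sup>+"
  using assms
proof (induction \<pi> arbitrary: u)
  case (Cons tz \<pi>)
  obtain t z where tz: "tz = (t, z)" by fastforce
  show ?case
  proof (cases "\<pi> = []")
    case True
    then show ?thesis using Cons.prems link_iff_sat by (fastforce simp: tz terms_of_def)
  next
    case False
    then obtain w where "sat A [(t, z)] u w a b" "sat A \<pi> w v a b"
      using Cons.prems(1) unfolding tz sat_Cons_iff[OF False] by blast
    moreover have "t \<in> F" "terms_of \<pi> \<subseteq> F" using Cons.prems(3) by (auto simp: tz terms_of_def)
    ultimately have "(u, w) \<in> link F A a b" "(w, v) \<in> (link F A a b)\<^sup>+"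
      using Cons.IH False unfolding link_iff_sat by blast+
    then show ?thesis by (rule trancl_into_trancl2)
  qed
qed simp

lemma trancl_link_imp_sat:
  assumes "(u, v) \<in> (link F A a b)\<^sup>+"
  shows "\<exists>\<pi>. \<pi> \<noteq> [] \<and> terms_of \<pi> \<subseteq> F \<and> sat A \<pi> u v a b"
  using assms
proof (induction rule: converse_trancl_induct)
  case (base u)
  then obtain t z where "t \<in> F" "sat A [(t, z)] u v a b" unfolding link_iff_sat by blast
  then show ?case by (intro exI[of _ "[(t, z)]"]) (simp add: terms_of_def)
next
  case (step u w)
  then obtain t z \<pi> where "t \<in> F" "sat A [(t, z)] u w a b"
    "\<pi> \<noteq> []" "terms_of \<pi> \<subseteq> F" "sat A \<pi> w v a b"
    unfolding link_iff_sat by blast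
  then show ?case
    by (intro exI[of _ "(t, z) # \<pi>"]) (auto simp: terms_of_def sat_Cons_iff)
qed

text \<open>Formulas are nonempty lists, which gives the transitive closure; the diagonal,
  restricted to the carrier, comes in separately. As \<open>F \<subseteq> T\<close>, a nonempty list
  of terms in \<open>F\<close> is a congruence formula.\<close>

lemma theta_of_eq_trancl:
  assumes "F \<subseteq> T"
  shows "theta_of T F A a b =
    {(c, d). c \<in> carrier A \<and> d \<in> carrier A \<and> (c = d \<or> (c, d) \<in> (link F A a b)\<^sup>+)}"
proof -
  have "(\<exists>\<pi>. congruence_formula T \<pi> \<and> terms_of \<pi> \<subseteq> F \<and> sat A \<pi> c d a b) \<longleftrightarrow>
      (c, d) \<in> (link F A a b)\<^sup>+" for c d
    using assms sat_imp_trancl_link[of A _ c d a b F] trancl_link_imp_sat[of c d F A a b]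
    unfolding congruence_formula_def by blast
  then show ?thesis unfolding theta_of_def by simp
qed

lemma equiv_theta_of:
  assumes "F \<subseteq> T"
  shows "equiv (carrier A) (theta_of T F A a b)"
proof -
  have "sym ((link F A a b)\<^sup>+)" by (intro sym_trancl) (auto simp: link_def sym_def)
  then show ?thesis
    unfolding theta_of_eq_trancl[OF assms]
    by (intro equivI) (auto simp: refl_on_def sym_def trans_def intro: trancl_trans)
qed

lemma maps_of_theta_of:
  assumes "is_algebra \<sigma> A" "translation_terms \<sigma> T" "F \<subseteq> T" "a \<in> carrier A" "b \<in> carrier A"
    "f \<in> maps_of F A"
  shows "(f a, f b) \<in> theta_of T F A a b"
proof -
  have "f a \<in> carrier A" "f b \<in> carrier A"
    using maps_of_closed[OF assms(1) _ assms(6)] assms(3-5) translation_terms_wf[OF assms(2)]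
    by blast+
  moreover have "(f a, f b) \<in> link F A a b" using assms(6) by (auto simp: link_def)
  ultimately show ?thesis by (auto simp: theta_of_eq_trancl[OF assms(3)])
qed

text \<open>With \<open>equiv_theta_of\<close> and \<open>maps_of_theta_of\<close> this is the
  universal property of the generated equivalence. From here on it replaces all reasoning about
  formulas and chains.\<close>

lemma theta_of_least:
  assumes "F \<subseteq> T" "equiv (carrier A) \<psi>" "\<And>f. f \<in> maps_of F A \<Longrightarrow> (f a, f b) \<in> \<psi>"
  shows "theta_of T F A a b \<subseteq> \<psi>"
proof -
  have \<psi>: "refl_on (carrier A) \<psi>" "sym \<psi>" "trans \<psi>" using assms(2) by (auto simp: equiv_def)
  have "link F A a b \<subseteq> \<psi>" using assms(3) \<psi>(2) by (auto simp: link_def sym_def)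
  then have "(link F A a b)\<^sup>+ \<subseteq> \<psi>" using \<psi>(3) trancl_mono_subset trancl_id by metis
  then show ?thesis using \<psi>(1) by (auto simp: theta_of_eq_trancl[OF assms(1)] refl_on_def)
qed

text \<open>Every congruence containing \<open>(a, b)\<close> is preserved by the term maps, hence
  is one of the equivalences over which \<open>theta_of T F A a b\<close> is least.\<close>

lemma theta_of_subset_principal:
  assumes "translation_terms \<sigma> T" "F \<subseteq> T"
  shows "theta_of T F A a b \<subseteq> principal_congruence \<sigma> A a b"
  unfolding principal_congruence_def
proof (intro Inter_greatest, elim CollectE conjE)
  fix \<psi> assume \<psi>: "is_congruence \<sigma> A \<psi>" "(a, b) \<in> \<psi>"
  show "theta_of T F A a b \<subseteq> \<psi>"
  proof (rule theta_of_least[OF assms(2)])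
    show "equiv (carrier A) \<psi>" using \<psi>(1) by (simp add: is_congruence_def)
    show "(f a, f b) \<in> \<psi>" if "f \<in> maps_of F A" for f
      using that assms trm_map_congruence[OF \<psi>(1) _ \<psi>(2)] translation_terms_wf[OF assms(1)]
      unfolding maps_of_def by blast
  qed
qed

section \<open>From FDSC to TFPSC\<close>

lemma FDSC_imp_TFPSC:
  fixes \<sigma> :: "'f signature" and \<C> :: "('f, 'a) ualg set"
  assumes T: "translation_terms \<sigma> T" and alg: "\<forall>A\<in>\<C>. is_algebra \<sigma> A" and "FDSC T \<C>"
  shows "TFPSC \<sigma> T \<C>"
proof -
  obtain G where G: "finite G" "G \<subseteq> T"
    and syn: "\<And>A \<theta>. A \<in> \<C> \<Longrightarrow> equiv (carrier A) \<theta> \<Longrightarrow> syn T A \<theta> = rel_of G A \<theta>"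
    using assms(3) unfolding FDSC_def by auto
  have X: "{Var X} \<subseteq> T" using translation_terms_Var[OF T] by simp
  \<comment> \<open>The given pair serves as its own subpair: \<open>c = a\<close> and
    \<open>d = b\<close>, with the identity \<open>Var X\<close> as the only term of the first set
    and the FDSC set as the second.\<close>
  have main: "(a, b) \<in> theta_of T {Var X} A a b \<and>
      principal_congruence \<sigma> A a b = theta_of T G A a b"
    if A: "A \<in> \<C>" and ab: "a \<in> carrier A" "b \<in> carrier A" for A :: "('f, 'a) ualg" and a b
  proof
    have "is_algebra \<sigma> A" using alg A by blast
    note in_theta = maps_of_theta_of[OF this T _ ab]
    show "(a, b) \<in> theta_of T {Var X} A a b"
      using in_theta[OF X maps_of_id] ab by simp
    let ?\<Theta> = "theta_of T G A a b"
    have eq: "equiv (carrier A) ?\<Theta>" by (rule equiv_theta_of[OF G(2)])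
    have "(a, b) \<in> rel_of G A ?\<Theta>" using in_theta[OF G(2)] ab unfolding rel_of_def by blast
    then have "(a, b) \<in> syn T A ?\<Theta>" using syn[OF A eq] by simp
    moreover have "is_congruence \<sigma> A (syn T A ?\<Theta>)"
      by (rule is_congruence_syn[OF \<open>is_algebra \<sigma> A\<close> T eq])
    ultimately have "principal_congruence \<sigma> A a b \<subseteq> syn T A ?\<Theta>"
      unfolding principal_congruence_def by blast
    also have "\<dots> \<subseteq> ?\<Theta>" by (rule syn_subset[OF T])
    finally show "principal_congruence \<sigma> A a b = ?\<Theta>"
      by (rule equalityI) (rule theta_of_subset_principal[OF T G(2)])
  qed
  show ?thesis
    unfolding TFPSC_def
  proof (rule exI[of _ "{Var X}"], rule exI[of _ G], intro conjI ballI impI)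
    fix A :: "('f, 'a) ualg" and a b
    assume "A \<in> \<C>" "a \<in> carrier A" "b \<in> carrier A" "a \<noteq> b"
    then show "\<exists>c\<in>carrier A. \<exists>d\<in>carrier A. c \<noteq> d \<and> (c, d) \<in> theta_of T {Var X} A a b \<and>
        principal_congruence \<sigma> A c d = theta_of T G A c d"
      using main by blast
  qed (use G X in simp_all)
qed

section \<open>The quotient by a congruence\<close>

text \<open>The carrier of the quotient is a system of representatives.\<close>

lemma quotient_in_class:
  assumes "closed_under_hom_images \<sigma> \<C>" "A \<in> \<C>" "is_algebra \<sigma> A" "is_congruence \<sigma> A \<psi>"
  obtains B h where "B \<in> \<C>" "is_algebra \<sigma> B" "is_hom \<sigma> A B h" "h ` carrier A = carrier B"
    "carrier B \<subseteq> carrier A" "\<And>x. x \<in> carrier A \<Longrightarrow> (x, h x) \<in> \<psi>"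
    "\<And>x y. (x, y) \<in> \<psi> \<Longrightarrow> h x = h y"
proof -
  have \<psi>: "refl_on (carrier A) \<psi>" "sym \<psi>" "trans \<psi>" "\<psi> \<subseteq> carrier A \<times> carrier A"
    using assms(4) by (auto simp: is_congruence_def equiv_def)
  define h where "h x = (SOME y. (x, y) \<in> \<psi>)" for x
  define B where "B = \<lparr>carrier = h ` carrier A, oper = \<lambda>f as. h (oper A f as)\<rparr>"
  have h: "(x, h x) \<in> \<psi>" if "x \<in> carrier A" for x
    unfolding h_def by (rule someI[of _ x]) (use \<psi>(1) that in \<open>simp add: refl_on_def\<close>)
  have h_eq: "h x = h y" if "(x, y) \<in> \<psi>" for x y
  proof -
    \<comment> \<open>Related elements have the same class, so the choice operator is applied to the
      same predicate and returns the same representative.\<close>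
    have "(x, z) \<in> \<psi> \<longleftrightarrow> (y, z) \<in> \<psi>" for z
      using that \<psi>(2,3) by (meson symD transD)
    then show ?thesis by (simp add: h_def)
  qed
  have sub: "carrier B \<subseteq> carrier A" using h \<psi>(4) by (auto simp: B_def)
  have "is_algebra \<sigma> B"
    using assms(3) sub unfolding is_algebra_def by (auto simp: B_def)
  moreover have "is_hom \<sigma> A B h"
    unfolding is_hom_def
  proof (intro conjI allI impI, goal_cases)
    case (2 f n as)
    \<comment> \<open>Replacing arguments by their representatives changes the value only within its
      \<psi>-class, so the representative of the value stays the same.\<close>
    then have "list_all2 (\<lambda>a b. (a, b) \<in> \<psi>) as (map h as)"
      using h by (auto simp: list_all2_conv_all_nth subset_iff)
    then have "(oper A f as, oper A f (map h as)) \<in> \<psi>"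
      using assms(4) 2 unfolding is_congruence_def by blast
    then show ?case by (simp add: B_def h_eq)
  qed (simp add: B_def)
  moreover have "h ` carrier A = carrier B" by (simp add: B_def)
  moreover from calculation have "B \<in> \<C>"
    using assms(1,2) unfolding closed_under_hom_images_def by blast
  ultimately show ?thesis using that[of B h, OF _ _ _ _ sub h h_eq] by simp
qed

section \<open>From TFPSC to FDSC\<close>

lemma TFPSC_imp_FDSC:
  fixes \<sigma> :: "'f signature" and T :: "'f trm set" and \<C> :: "('f, 'a) ualg set"
  assumes T: "translation_terms \<sigma> T" and alg: "\<forall>A\<in>\<C>. is_algebra \<sigma> A"
    and cl: "closed_under_hom_images \<sigma> \<C>" and "TFPSC \<sigma> T \<C>"
  shows "FDSC T \<C>"
proof -
  note wf = translation_terms_wf[OF T]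
  obtain F G where F: "finite F" "F \<subseteq> T" and G: "finite G" "G \<subseteq> T"
    and FG: "\<forall>A\<in>\<C>. \<forall>a\<in>carrier A. \<forall>b\<in>carrier A. a \<noteq> b \<longrightarrow>
           (\<exists>c\<in>carrier A. \<exists>d\<in>carrier A. c \<noteq> d \<and> (c, d) \<in> theta_of T F A a b \<and>
              principal_congruence \<sigma> A c d = theta_of T G A c d)"
    using assms(4) unfolding TFPSC_def by (elim exE conjE) (rule that)
  \<comment> \<open>One composite term is fixed for each pair, before any algebra is considered;
    this makes \<open>H\<close> a finite set valid for the whole class.\<close>
  define comp where "comp s t = (SOME r. r \<in> T \<and> (\<forall>(A :: ('f, 'a) ualg) p q.
      range p \<subseteq> carrier A \<and> range q \<subseteq> carrier A \<longrightarrow>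
      (\<exists>e. range e \<subseteq> carrier A \<and> (\<forall>a. trm_map A r e a = trm_map A s p (trm_map A t q a)))))"
    for s t
  have comp_ex: "comp s t \<in> T \<and> (\<forall>(A :: ('f, 'a) ualg) p q.
      range p \<subseteq> carrier A \<and> range q \<subseteq> carrier A \<longrightarrow>
      (\<exists>e. range e \<subseteq> carrier A \<and>
        (\<forall>a. trm_map A (comp s t) e a = trm_map A s p (trm_map A t q a))))"
    if "s \<in> T" "t \<in> T" for s t
    unfolding comp_def
    by (rule someI_ex) (rule translation_terms_compose[OF T that, unfolded Bex_def])
  define H where "H = (\<lambda>(s, t). comp s t) ` (G \<times> F)"
  have H: "finite H" "H \<subseteq> T" using F G comp_ex by (auto simp: H_def)
  have compose: "(\<lambda>x. g (f x)) \<in> maps_of H A"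
    if gf: "g \<in> maps_of G A" "f \<in> maps_of F A" for g f and A :: "('f, 'a) ualg"
  proof -
    obtain s p t q where *: "g = trm_map A s p" "s \<in> G" "range p \<subseteq> carrier A"
      "f = trm_map A t q" "t \<in> F" "range q \<subseteq> carrier A"
      using gf unfolding maps_of_def by blast
    then obtain e where e: "range e \<subseteq> carrier A"
      "\<forall>a. trm_map A (comp s t) e a = trm_map A s p (trm_map A t q a)"
      using comp_ex[THEN conjunct2, rule_format, of s t p A q] F(2) G(2) by blast
    have "(\<lambda>x. g (f x)) = trm_map A (comp s t) e" using e(2) by (simp add: * fun_eq_iff)
    moreover have "comp s t \<in> H" using * by (auto simp: H_def)
    ultimately show ?thesis using e(1) unfolding maps_of_def by blast
  qed
  have "rel_of H A \<theta> \<subseteq> syn T A \<theta>" if A: "A \<in> \<C>" and \<theta>: "equiv (carrier A) \<theta>" for A \<theta>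
  proof (rule subrelI, rule ccontr)
    fix a b assume ab: "(a, b) \<in> rel_of H A \<theta>" and not_syn: "(a, b) \<notin> syn T A \<theta>"
    have algA: "is_algebra \<sigma> A" using A alg by blast
    have abA: "a \<in> carrier A" "b \<in> carrier A" using ab by (auto simp: rel_of_def)
    have syn_cong: "is_congruence \<sigma> A (syn T A \<theta>)" by (rule is_congruence_syn[OF algA T \<theta>])
    obtain B h where B: "B \<in> \<C>" "is_algebra \<sigma> B" and hom: "is_hom \<sigma> A B h"
      and img: "h ` carrier A = carrier B" and sub: "carrier B \<subseteq> carrier A"
      and h: "\<And>x. x \<in> carrier A \<Longrightarrow> (x, h x) \<in> syn T A \<theta>"
      and h_eq: "\<And>x y. (x, y) \<in> syn T A \<theta> \<Longrightarrow> h x = h y"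
      by (rule quotient_in_class[OF cl A algA syn_cong]) (rule that)
    \<comment> \<open>Write \<open>y = h x\<close>; then \<open>x\<close> and \<open>h x\<close> are
      related by \<open>syn T A \<theta>\<close>, so \<open>h\<close> takes the same value on
      both.\<close>
    have h_fix: "h y = y" if "y \<in> carrier B" for y
      using that img h h_eq by (metis imageE)
    have \<theta>': "refl_on (carrier A) \<theta>" "sym \<theta>" "trans \<theta>" using \<theta> by (auto simp: equiv_def)
    have h\<theta>: "(x, h x) \<in> \<theta>" if "x \<in> carrier A" for x
      using h[OF that] syn_subset[OF T] by blast
    \<comment> \<open>Since \<open>syn T A \<theta>\<close> lies in \<theta>, passing to
      representatives neither creates nor destroys \<theta>-pairs.\<close>
    have h\<theta>_iff: "(h x, h y) \<in> \<theta> \<longleftrightarrow> (x, y) \<in> \<theta>" if "x \<in> carrier A" "y \<in> carrier A" for x y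
      using h\<theta>[OF that(1)] h\<theta>[OF that(2)] \<theta>'(2,3) by (meson symD transD)
    \<comment> \<open>The image of \<theta> in the quotient: as \<open>B\<close> consists of
      representatives, it is just the restriction of \<theta>.\<close>
    define \<eta> where "\<eta> = \<theta> \<inter> carrier B \<times> carrier B"
    have \<eta>: "equiv (carrier B) \<eta>"
    proof (rule equivI)
      show "refl_on (carrier B) \<eta>" using \<theta>'(1) sub by (auto simp: \<eta>_def refl_on_def)
      show "sym \<eta>" using \<theta>'(2) by (auto simp: \<eta>_def sym_def)
      show "trans \<eta>" using \<theta>'(3) unfolding \<eta>_def trans_def by blast
    qed (simp add: \<eta>_def)
    have syn_sym_trans: "sym (syn T A \<theta>)" "trans (syn T A \<theta>)"
      using syn_cong by (auto simp: is_congruence_def equiv_def)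
    have "h a \<noteq> h b"
    proof
      assume "h a = h b"
      then have "(a, b) \<in> syn T A \<theta>"
        using h[OF abA(1)] h[OF abA(2)] syn_sym_trans by (metis symD transD)
      then show False using not_syn by blast
    qed
    moreover have hab: "h a \<in> carrier B" "h b \<in> carrier B" using img abA by auto
    ultimately obtain c d where cd: "c \<in> carrier B" "d \<in> carrier B" "c \<noteq> d"
      and cd_theta: "(c, d) \<in> theta_of T F B (h a) (h b)"
      and princ: "principal_congruence \<sigma> B c d = theta_of T G B c d"
      using FG B(1) by blast
    \<comment> \<open>Parameters from \<open>B\<close> are also parameters in \<open>A\<close> and
      are fixed by \<open>h\<close>, so the assumption on \<open>(a, b)\<close> in \<open>A\<close>
      carries over along \<open>h\<close>.\<close>
    have H\<eta>: "(f (h a), f (h b)) \<in> \<eta>" if fH: "f \<in> maps_of H B" for f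
    proof -
      obtain t e where t: "t \<in> H" "range e \<subseteq> carrier B" and f: "f = trm_map B t e"
        using fH unfolding maps_of_def by blast
      have eA: "range e \<subseteq> carrier A" and he: "h \<circ> e = e"
        using t(2) sub h_fix by (auto simp: fun_eq_iff)
      have wft: "wf_trm \<sigma> t" using t(1) H(2) wf by blast
      have val: "f (h x) = h (trm_map A t e x)" "trm_map A t e x \<in> carrier A"
        if "x \<in> carrier A" for x
        using trm_map_hom[OF algA hom wft that eA] trm_map_closed[OF algA wft that eA]
        by (simp_all add: f he)
      have "(trm_map A t e a, trm_map A t e b) \<in> \<theta>"
        using ab t(1) eA unfolding rel_of_def maps_of_def by blast
      then show ?thesis using val abA h\<theta>_iff img by (auto simp: \<eta>_def)
    qed
    \<comment> \<open>The right side is an equivalence, and it contains the generating pairs because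
      a map from \<open>F\<close> followed by one from \<open>G\<close> is a map from
      \<open>H\<close>.\<close>
    have "theta_of T F B (h a) (h b) \<subseteq> rel_of G B \<eta>"
    proof (rule theta_of_least[OF F(2)])
      show "equiv (carrier B) (rel_of G B \<eta>)"
        using equiv_rel_of[OF B(2) _ \<eta>] G(2) wf by blast
      fix f assume f: "f \<in> maps_of F B"
      have "f (h a) \<in> carrier B" "f (h b) \<in> carrier B"
        using maps_of_closed[OF B(2) _ f] F(2) wf hab by blast+
      then show "(f (h a), f (h b)) \<in> rel_of G B \<eta>"
        using H\<eta> compose[OF _ f] unfolding rel_of_def by auto
    qed
    \<comment> \<open>Now \<open>(c, d)\<close> lies in \<open>rel_of G B \<eta>\<close>: the maps
      from \<open>G\<close> send it into \<eta>, and leastness applies again.\<close>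
    then have "theta_of T G B c d \<subseteq> \<eta>"
      using cd_theta by (intro theta_of_least[OF G(2) \<eta>]) (auto simp: rel_of_def)
    then have princ_\<eta>: "principal_congruence \<sigma> B c d \<subseteq> \<eta>" using princ by simp
    \<comment> \<open>The elements \<open>c\<close> and \<open>d\<close> also belong to
      \<open>A\<close>. The aim is to show that they are related by \<open>syn T A \<theta>\<close>,
      although they are distinct representatives.\<close>
    have "(f c, f d) \<in> \<theta>" if fT: "f \<in> maps_of T A" for f
    proof -
      obtain t e where t: "t \<in> T" and e: "range e \<subseteq> carrier A" and f: "f = trm_map A t e"
        using fT unfolding maps_of_def by blast
      \<comment> \<open>The parameters of \<open>f\<close> lie in \<open>A\<close> only. Moving them
        to \<open>B\<close> by \<open>h\<close> yields a map of \<open>B\<close> whose values at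
        elements of \<open>B\<close> are the representatives of the values of
        \<open>f\<close>.\<close>
      have "range (h \<circ> e) \<subseteq> carrier B" using e img by auto
      then have "trm_map B t (h \<circ> e) \<in> maps_of T B" using t unfolding maps_of_def by blast
      from maps_of_theta_of[OF B(2) T subset_refl cd(1,2) this]
      have "(trm_map B t (h \<circ> e) c, trm_map B t (h \<circ> e) d) \<in> \<eta>"
        using theta_of_subset_principal[OF T subset_refl] princ_\<eta> by (meson subsetD)
      then have "(trm_map B t (h \<circ> e) c, trm_map B t (h \<circ> e) d) \<in> \<theta>" by (simp add: \<eta>_def)
      moreover have "trm_map B t (h \<circ> e) x = h (f x) \<and> f x \<in> carrier A" if "x \<in> carrier B" for x
      proof -
        have x: "x \<in> carrier A" using that sub by blast
        show ?thesis
          using trm_map_hom[OF algA hom wf[OF t] x e] trm_map_closed[OF algA wf[OF t] x e]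
          by (simp add: f h_fix[OF that])
      qed
      ultimately show ?thesis using cd(1,2) h\<theta>_iff by simp
    qed
    then have "(c, d) \<in> syn T A \<theta>"
      using cd(1,2) sub unfolding syn_def rel_of_def by auto
    \<comment> \<open>Related elements have equal images under \<open>h\<close>, while
      \<open>h\<close> fixes the distinct elements \<open>c\<close> and \<open>d\<close>.\<close>
    from h_eq[OF this] show False using h_fix cd by simp
  qed
  then have "syn T A \<theta> = rel_of H A \<theta>" if "A \<in> \<C>" "equiv (carrier A) \<theta>" for A \<theta>
    using that rel_of_mono[OF H(2), of A \<theta>] by (intro equalityI) (simp_all add: syn_def)
  then show ?thesis
    unfolding FDSC_def by (intro exI[of _ H] conjI H ballI allI impI)
qed

theorem theorem3p3:
  fixes \<sigma> :: "'f signature" and T :: "'f trm set" and \<C> :: "('f, 'a) ualg set"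
  assumes "finite (dom \<sigma>)"
    and "translation_terms \<sigma> T"
    and "\<forall>A\<in>\<C>. is_algebra \<sigma> A"
    and "closed_under_hom_images \<sigma> \<C>"
  shows "FDSC T \<C> \<longleftrightarrow> TFPSC \<sigma> T \<C>"
  by (rule iffI) (fact FDSC_imp_TFPSC[OF assms(2,3)], fact TFPSC_imp_FDSC[OF assms(2-4)])

end
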